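(* Let $n$ be a positive integer and let $Q_n(z)$ be the $n$-th Yablonskii--Vorob'ev polynomial. If $n(n+1)/2$ is divisible by $3$, i.e. $n\equiv 0 \pmod 3$ or $n\equiv 2\pmod 3$, then $Q_n(z)$ is a polynomial in $z^3$. If $n(n+1)/2$ is not divisible by $3$, i.e. $n\equiv 1\pmod 3$, then the constant term of $Q_n(z)$ is zero and $Q_n(z)/z$ is a polynomial in $z^3$.
   Context: Yablonskii--Vorob'ev polynomials: $Q_0(z)=1$, $Q_1(z)=z$, and $Q_{n+1}Q_{n-1}=zQ_n^2-4\left(Q_nQ_n''-(Q_n')^2\right)$ for $n\ge 1$. Known facts taken as given: each $Q_n$ is a monic polynomial with integer coefficients, of degree $n(n+1)/2$, with only simple roots, and for $n\ge1$ the function $w(z;n)=\frac{d}{dz}\ln\frac{Q_{n-1}(z)}{Q_n(z)}$ is a rational solution of the second Painlevé equation $w_{zz}=2w^3+zw+\alpha$ with $\alpha=n$. *)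

theory Defs
  imports Complex_Main "HOL-Computational_Algebra.Polynomial"
begin

(* The quotient (z Q_n^2 - 4 (Q_n Q_n'' - (Q_n')^2)) / Q_(n-1) is not computed with the truncating
   polynomial division; the recurrence is required as an exact identity in the polynomial ring. *)
definition yablonskii_vorobev :: "(nat \<Rightarrow> complex poly) \<Rightarrow> bool" where
  "yablonskii_vorobev Q \<longleftrightarrow>
     Q 0 = 1 \<and> Q 1 = [:0, 1:] \<and>
     (\<forall>n\<ge>1. Q (n + 1) * Q (n - 1) =
        [:0, 1:] * (Q n)^2 - 4 * (Q n * pderiv (pderiv (Q n)) - (pderiv (Q n))^2))"

definition polynomial_in_cube :: "complex poly \<Rightarrow> bool" where
  "polynomial_in_cube p \<longleftrightarrow> (\<exists>r. p = r \<circ>\<^sub>p monom 1 3)"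

end

(* For a cube root of unity w, the recurrence is covariant under z -> w z: by induction
   Q_n(w z) = w^(n(n+1)/2) Q_n(z). The induction step divides by Q_(n-1), which is nonzero because
   z Q_n^2 has larger degree than the derivative terms. For w other than 1, comparing coefficients
   shows that only the exponents congruent to n(n+1)/2 modulo 3 occur in Q_n. *)
theory Submission imports Defs
begin

lemma pcompose_monom: "pcompose (monom a k) q = smult a (q ^ k)"
  for q :: "'a::comm_semiring_1 poly"
  by (induction k) (simp_all add: monom_0 monom_Suc pcompose_pCons)

lemma polynomial_in_cubeI:
  assumes "\<And>i. coeff p i \<noteq> 0 \<Longrightarrow> 3 dvd i"
  shows "polynomial_in_cube p"
proof -
  \<comment> \<open>The witness moves the coefficient at \<open>i\<close> to the exponent
    \<open>i div 3\<close>. Substituting the cube brings it back to \<open>i\<close> whenever 3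
    divides \<open>i\<close>, and all other terms are zero by assumption.\<close>
  define r where "r = (\<Sum>i\<le>degree p. monom (coeff p i) (i div 3))"
  have "pcompose r (monom 1 3) = (\<Sum>i\<le>degree p. monom (coeff p i) i)"
    unfolding r_def pcompose_sum
  proof (rule sum.cong)
    fix i
    show "pcompose (monom (coeff p i) (i div 3)) (monom 1 3) = monom (coeff p i) i"
      using assms[of i] by (cases "coeff p i = 0") (auto simp: pcompose_monom monom_power smult_monom)
  qed simp
  then show ?thesis
    unfolding polynomial_in_cube_def poly_as_sum_of_monoms by metis
qed

lemma yablonskii_vorobev_rec:
  assumes "yablonskii_vorobev Q"
  shows "Q (Suc (Suc n)) * Q n = [:0, 1:] * (Q (Suc n))\<^sup>2
    - 4 * (Q (Suc n) * pderiv (pderiv (Q (Suc n))) - (pderiv (Q (Suc n)))\<^sup>2)"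
  using conjunct2[OF conjunct2[OF assms[unfolded yablonskii_vorobev_def]], rule_format, of "Suc n"]
  by simp

lemma yablonskii_vorobev_init:
  assumes "yablonskii_vorobev Q"
  shows "Q 0 = 1" "Q 1 = [:0, 1:]"
  using assms unfolding yablonskii_vorobev_def by blast+

text \<open>The left side has degree exactly \<open>2 * degree p + 1\<close>, while the right side
  has degree at most \<open>2 * degree p\<close>. Hence the right side of the recurrence cannot
  vanish when \<open>Q n\<close> is nonzero.\<close>

lemma X_times_square_neq_derivative_terms:
  fixes p :: "complex poly"
  assumes "p \<noteq> 0"
  shows "[:0, 1:] * p\<^sup>2 \<noteq> 4 * (p * pderiv (pderiv p) - (pderiv p)\<^sup>2)"
proof
  assume eq: "[:0, 1:] * p\<^sup>2 = 4 * (p * pderiv (pderiv p) - (pderiv p)\<^sup>2)"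
  have "degree (p * pderiv (pderiv p)) \<le> 2 * degree p"
    using degree_mult_le[of p "pderiv (pderiv p)"] by (simp add: degree_pderiv)
  moreover have "degree ((pderiv p)\<^sup>2) \<le> 2 * degree p"
    using degree_power_le[of "pderiv p" 2] by (simp add: degree_pderiv)
  ultimately have "degree (p * pderiv (pderiv p) - (pderiv p)\<^sup>2) \<le> 2 * degree p"
    by (rule degree_diff_le)
  then have "degree (4 * (p * pderiv (pderiv p) - (pderiv p)\<^sup>2)) \<le> 2 * degree p"
    by (simp add: numeral_poly)
  moreover have "degree ([:0, 1:] * p\<^sup>2) = Suc (2 * degree p)"
    using assms by (simp add: degree_mult_eq degree_power_eq)
  ultimately show False
    unfolding eq by linarith
qed

lemma yablonskii_vorobev_nonzero:
  assumes "yablonskii_vorobev Q"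
  shows "Q n \<noteq> 0"
proof (induction n rule: less_induct)
  case (less n)
  consider "n = 0" | "n = 1" | m where "n = Suc (Suc m)"
    by (metis One_nat_def not0_implies_Suc)
  then show ?case
  proof cases
    case 3
    have "Q (Suc m) \<noteq> 0"
      using less 3 by simp
    \<comment> \<open>If \<open>Q (m + 2)\<close> were zero, the product on the left of the
      recurrence would vanish, and its right side with it.\<close>
    from X_times_square_neq_derivative_terms[OF this] show ?thesis
      using yablonskii_vorobev_rec[OF assms, of m] 3 by auto
  qed (simp_all add: yablonskii_vorobev_init[OF assms, unfolded One_nat_def])
qed

lemma triangular_Suc: "Suc n * (Suc n + 1) div 2 = n * (n + 1) div 2 + Suc n"
proof -
  have "Suc n * (Suc n + 1) = n * (n + 1) + Suc n * 2"
    by simp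
  then show ?thesis
    by (simp only: div_mult_self1 add.commute)
qed

lemma yablonskii_vorobev_rotate:
  assumes Q: "yablonskii_vorobev Q" and w: "w ^ 3 = 1"
  shows "pcompose (Q n) [:0, w:] = smult (w ^ (n * (n + 1) div 2)) (Q n)"
proof (induction n rule: less_induct)
  case (less n)
  consider "n = 0" | "n = 1" | m where "n = Suc (Suc m)"
    by (metis One_nat_def not0_implies_Suc)
  then show ?case
  proof cases
    case 3
    define p where "p = Q (Suc m)"
    define T where "T k = k * (k + 1) div 2" for k :: nat
    define c where "c = w ^ T (Suc m)"
    let ?R = "\<lambda>f. pcompose f [:0, w:]"
    have w0: "w \<noteq> 0"
      using w by auto
    have Rp: "?R p = smult c p"
      using less[of "Suc m"] 3 by (simp add: p_def c_def T_def)
    have d: "smult w (?R (pderiv f)) = pderiv (?R f)" for f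
      by (simp add: pderiv_pcompose pderiv_pCons)
    \<comment> \<open>The chain rule \<open>d\<close> carries a factor \<open>w\<close> on the left.
      As \<open>w ^ 3 = 1\<close>, multiplying by \<open>w\<^sup>2\<close> removes it, so no inverse
      of \<open>w\<close> is needed.\<close>
    have div: "?R (pderiv f) = smult (w\<^sup>2) (pderiv (?R f))" for f
    proof -
      have "smult (w\<^sup>2) (pderiv (?R f)) = smult (w\<^sup>2 * w) (?R (pderiv f))"
        by (simp flip: d)
      also have "w\<^sup>2 * w = 1"
        using w by (simp add: power2_eq_square power3_eq_cube)
      finally show ?thesis
        by simp
    qed
    have w4: "w\<^sup>2 * w\<^sup>2 = w"
      using w by (simp add: power2_eq_square power3_eq_cube mult.assoc)
    have Rp': "?R (pderiv p) = smult (w\<^sup>2 * c) (pderiv p)"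
      by (simp add: div Rp pderiv_smult)
    have "?R (pderiv (pderiv p)) = smult ((w\<^sup>2 * w\<^sup>2) * c) (pderiv (pderiv p))"
      by (simp only: div[of "pderiv p"] Rp' pderiv_smult smult_smult mult.assoc)
    then have Rp'': "?R (pderiv (pderiv p)) = smult (w * c) (pderiv (pderiv p))"
      by (simp only: w4)
    \<comment> \<open>All three terms of the recurrence acquire the same factor: \<open>w\<close>
      comes from z and \<open>c\<^sup>2\<close> from the square of \<open>p\<close>; the second
      derivative contributes \<open>w * c\<close> and \<open>p\<close> contributes \<open>c\<close>;
      the squared first derivative contributes \<open>w ^ 4 * c\<^sup>2\<close>, where
      \<open>w ^ 4 = w\<close>.\<close>
    have Rpp: "?R (Q n * Q m) = smult (w * c\<^sup>2) (Q n * Q m)"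
    proof -
      have e: "Q n * Q m = [:0, 1:] * p\<^sup>2 - 4 * (p * pderiv (pderiv p) - (pderiv p)\<^sup>2)"
        using yablonskii_vorobev_rec[OF Q, of m] 3 p_def by simp
      have "(w\<^sup>2 * c)\<^sup>2 = w * c\<^sup>2"
        by (simp only: power_mult_distrib power2_eq_square[of "w\<^sup>2"] w4)
      then have "(?R (pderiv p))\<^sup>2 = smult (w * c\<^sup>2) ((pderiv p)\<^sup>2)"
        by (simp only: Rp' smult_power)
      moreover have "?R p * ?R (pderiv (pderiv p)) = smult (w * c\<^sup>2) (p * pderiv (pderiv p))"
        by (simp add: Rp Rp'' power2_eq_square mult_ac)
      moreover have "?R [:0, 1:] * (?R p)\<^sup>2 = smult (w * c\<^sup>2) ([:0, 1:] * p\<^sup>2)"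
        by (simp add: Rp pcompose_pCons smult_power mult.commute)
      moreover have "?R (f\<^sup>2) = (?R f)\<^sup>2" "?R 4 = 4" for f
        by (simp_all add: power2_eq_square pcompose_mult numeral_poly)
      ultimately show ?thesis
        by (simp only: e pcompose_diff pcompose_mult smult_diff_right mult_smult_right right_diff_distrib)
    qed
    have Rm: "?R (Q m) = smult (w ^ T m) (Q m)"
      using less[of m] 3 by (simp add: T_def)
    have "?R (Q n) * ?R (Q m) = ?R (Q n * Q m)"
      by (simp only: pcompose_mult)
    also have "\<dots> = smult (w ^ T n) (Q n) * ?R (Q m)"
    proof -
      have "T (Suc k) = T k + Suc k" for k
        unfolding T_def by (rule triangular_Suc)
      \<comment> \<open>This identity between triangular numbers splits the common factor
        \<open>w * c\<^sup>2\<close> into the known factor of \<open>Q m\<close> and the claimed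
        factor of \<open>Q n\<close>.\<close>
      then have "T m + T n = Suc (2 * T (Suc m))"
        using 3 by simp
      then have "w * c\<^sup>2 = w ^ T n * w ^ T m"
        by (simp add: c_def mult.commute add.commute flip: power_add power_mult)
      then show ?thesis
        by (simp add: Rpp Rm mult.commute[of "w ^ T n"])
    qed
    \<comment> \<open>The factor \<open>?R (Q m)\<close> cancels: it is \<open>Q m\<close> scaled by
      a power of \<open>w\<close>, and both are nonzero.\<close>
    finally show ?thesis
      using yablonskii_vorobev_nonzero[OF Q, of m] w0
      by (simp add: Rm T_def del: mult_smult_left mult_smult_right)
  qed (simp_all add: yablonskii_vorobev_init[OF Q, unfolded One_nat_def] pcompose_pCons pcompose_1)
qed

text \<open>There are exactly three complex cube roots of unity, so 1 cannot be the only
  one.\<close>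

lemma primitive_cube_root_of_unity_exists: "\<exists>w::complex. w ^ 3 = 1 \<and> w \<noteq> 1"
proof (rule ccontr)
  assume "\<not> ?thesis"
  then have "{w::complex. w ^ 3 = 1} = {1}"
    by auto
  then show False
    using card_roots_unity_eq[of 3] by simp
qed

text \<open>Such a \<open>w\<close> has order exactly 3: the powers 1, \<open>w\<close> and
  \<open>w\<^sup>2\<close> are pairwise distinct, since any coincidence would force
  \<open>w = 1\<close>.\<close>

lemma cube_root_of_unity_power_eqD:
  fixes w :: complex
  assumes "w ^ 3 = 1" "w \<noteq> 1" "w ^ i = w ^ j"
  shows "i mod 3 = j mod 3"
proof -
  have red: "w ^ k = w ^ (k mod 3)" for k
    by (metis assms(1) mult.left_neutral mult_div_mod_eq power_add power_mult power_one)
  have w2: "w\<^sup>2 \<noteq> 1" "w\<^sup>2 \<noteq> w"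
    using assms(1,2) by (auto simp: power2_eq_square power3_eq_cube)
  have "w ^ (i mod 3) = w ^ (j mod 3)"
    using assms(3) red by metis
  moreover have "i mod 3 \<in> {0, 1, 2}" "j mod 3 \<in> {0, 1, 2}"
    by auto
  ultimately show ?thesis
    using w2 assms(2) by auto
qed

lemma yablonskii_vorobev_coeff_nonzeroD:
  assumes "yablonskii_vorobev Q" "coeff (Q n) i \<noteq> 0"
  shows "i mod 3 = (n * (n + 1) div 2) mod 3"
proof -
  obtain w :: complex where w: "w ^ 3 = 1" "w \<noteq> 1"
    using primitive_cube_root_of_unity_exists by blast
  \<comment> \<open>Substituting w z for z multiplies the coefficient of z to the power
    \<open>i\<close> by \<open>w ^ i\<close>.\<close>
  have "w ^ i * coeff (Q n) i = w ^ (n * (n + 1) div 2) * coeff (Q n) i"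
    using arg_cong[OF yablonskii_vorobev_rotate[OF assms(1) w(1), of n], of "\<lambda>p. coeff p i"]
    by (simp only: coeff_pcompose_linear coeff_smult)
  then have "w ^ i = w ^ (n * (n + 1) div 2)"
    using assms(2) by (simp only: mult_cancel_right) blast
  then show ?thesis
    by (rule cube_root_of_unity_power_eqD[OF w])
qed

text \<open>Passing from \<open>m\<close> to \<open>m + 3\<close> adds
  \<open>(m + 1) + (m + 2) + (m + 3) = 3 * (m + 2)\<close>, so the residue has period 3 and three
  initial values decide it.\<close>

lemma triangular_mod_3: "(n * (n + 1) div 2) mod 3 = (if n mod 3 = 1 then 1 else 0 :: nat)"
proof (induction n rule: less_induct)
  case (less n)
  consider "n = 0" | "n = 1" | "n = 2" | m where "n = Suc (Suc (Suc m))"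
    by (metis One_nat_def Suc_1 not0_implies_Suc)
  then show ?case
  proof cases
    case 4
    have "n * (n + 1) div 2 = m * (m + 1) div 2 + 3 * (m + 2)"
      unfolding 4 triangular_Suc by simp
    then have "n * (n + 1) div 2 mod 3 = m * (m + 1) div 2 mod 3"
      by (simp only: mod_mult_self2)
    moreover have "n mod 3 = m mod 3"
      unfolding 4 by presburger
    ultimately show ?thesis
      using less[of m] 4 by (simp only:)
  qed simp_all
qed

theorem mainTheorem3:
  fixes Q :: "nat \<Rightarrow> complex poly" and n :: nat
  assumes "yablonskii_vorobev Q" and "n > 0"
  shows "(3 dvd n * (n + 1) div 2 \<longleftrightarrow> n mod 3 = 0 \<or> n mod 3 = 2)
    \<and> (\<not> 3 dvd n * (n + 1) div 2 \<longleftrightarrow> n mod 3 = 1)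
    \<and> (3 dvd n * (n + 1) div 2 \<longrightarrow> polynomial_in_cube (Q n))
    \<and> (\<not> 3 dvd n * (n + 1) div 2 \<longrightarrow>
         coeff (Q n) 0 = 0 \<and> (\<exists>q. Q n = [:0, 1:] * q \<and> polynomial_in_cube q))"
proof (intro conjI impI)
  have dvd_iff: "3 dvd n * (n + 1) div 2 \<longleftrightarrow> n mod 3 \<noteq> 1"
    unfolding dvd_eq_mod_eq_0 triangular_mod_3 by simp
  then show "3 dvd n * (n + 1) div 2 \<longleftrightarrow> n mod 3 = 0 \<or> n mod 3 = 2"
    and "\<not> 3 dvd n * (n + 1) div 2 \<longleftrightarrow> n mod 3 = 1"
    by presburger+
  note exponent = yablonskii_vorobev_coeff_nonzeroD[OF assms(1), of n, unfolded triangular_mod_3]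
  show "polynomial_in_cube (Q n)" if "3 dvd n * (n + 1) div 2"
    using that exponent unfolding dvd_iff by (intro polynomial_in_cubeI) auto
  assume "\<not> 3 dvd n * (n + 1) div 2"
  then have exponent: "i mod 3 = 1" if "coeff (Q n) i \<noteq> 0" for i
    using exponent[OF that] dvd_iff by simp
  show const: "coeff (Q n) 0 = 0"
    using exponent[of 0] by auto
  obtain a q where "Q n = pCons a q"
    by (cases "Q n")
  with const have q: "Q n = [:0, 1:] * q"
    by simp
  \<comment> \<open>The coefficient of \<open>q\<close> at \<open>i\<close> is that of
    \<open>Q n\<close> at \<open>Suc i\<close>, so the residue 1 of the exponents drops to
    0.\<close>
  have "3 dvd i" if "coeff q i \<noteq> 0" for i
    using exponent[of "Suc i"] that unfolding q by simp presburger
  then show "\<exists>q. Q n = [:0, 1:] * q \<and> polynomial_in_cube q"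
    using q polynomial_in_cubeI by blast
qed

end
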